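(* Let $\mathcal{B}$ be the set of all open balls in a distance space $(X,d)$. Then every open ball in $\mathcal{B}$ is open in $(X,d)$ if and only if $\mathcal{B}$ is a base for a topology on $X$.
   Context: A distance on a set $X$ is a function $d:X\times X\to\mathbb{R}$ such that for all $x,y\in X$: $d(x,y)\ge 0$; $d(x,y)=0\iff x=y$; $d(x,y)=d(y,x)$ (no triangle inequality is assumed). The pair $(X,d)$ is then a distance space. For $x\in X$ and real $r>0$, the open ball is $B(x,r)=\{y\in X\mid d(x,y)<r\}$. A set $U\subseteq X$ is open in $(X,d)$ if for every $x\in U$ there exists a real $r>0$ such that $B(x,r)\subseteq U$ (note that open balls need not be open in this sense). A family $\mathcal{B}$ of subsets of $X$ is a base for a topology $T$ on $X$ if $\mathcal{B}\subseteq T$ and every $U\in T$ is a union of members of $\mathcal{B}$.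
   Formalization: "A topology on X" is taken to be the topology of all sets open in (X,d); for an arbitrary topology on X the "if" direction is false, since the open balls can be a base for another topology without all being open in (X,d). *)

theory Defs
  imports "HOL-Analysis.Analysis"
begin

text \<open>A distance need not satisfy the triangle inequality, so the library's
  \<^locale>\<open>Metric_space\<close> does not apply. The values of \<open>d\<close> outside \<open>X\<close> are irrelevant.\<close>

locale distance_space =
  fixes X :: "'a set" and d :: "'a \<Rightarrow> 'a \<Rightarrow> real"
  assumes nonneg: "\<lbrakk>x \<in> X; y \<in> X\<rbrakk> \<Longrightarrow> 0 \<le> d x y"
    and zero_iff: "\<lbrakk>x \<in> X; y \<in> X\<rbrakk> \<Longrightarrow> d x y = 0 \<longleftrightarrow> x = y"
    and commute: "\<lbrakk>x \<in> X; y \<in> X\<rbrakk> \<Longrightarrow> d x y = d y x"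

definition dball :: "'a set \<Rightarrow> ('a \<Rightarrow> 'a \<Rightarrow> real) \<Rightarrow> 'a \<Rightarrow> real \<Rightarrow> 'a set" where
  "dball X d x r = {y \<in> X. d x y < r}"

definition dballs :: "'a set \<Rightarrow> ('a \<Rightarrow> 'a \<Rightarrow> real) \<Rightarrow> 'a set set" where
  "dballs X d = {dball X d x r | x r. x \<in> X \<and> r > 0}"

definition dopen :: "'a set \<Rightarrow> ('a \<Rightarrow> 'a \<Rightarrow> real) \<Rightarrow> 'a set \<Rightarrow> bool" where
  "dopen X d U \<longleftrightarrow> U \<subseteq> X \<and> (\<forall>x \<in> U. \<exists>r > 0. dball X d x r \<subseteq> U)"

definition base_of :: "'a set set \<Rightarrow> 'a topology \<Rightarrow> bool" where
  "base_of \<B> T \<longleftrightarrow>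
     (\<forall>B \<in> \<B>. openin T B) \<and> (\<forall>U. openin T U \<longrightarrow> (\<exists>\<C> \<subseteq> \<B>. U = \<Union>\<C>))"

text \<open>The sets that are open in \<open>(X, d)\<close> always form a topology on \<open>X\<close>, with or without the
  triangle inequality; this is the topology meant when a base on a distance space is spoken of.
  For an arbitrary topology on \<open>X\<close> the balls may be a base without being open in \<open>(X, d)\<close>:
  a ball around \<open>z\<close> may serve as a basic neighbourhood of a point \<open>y\<close> although it contains no
  ball centred at \<open>y\<close>.\<close>

definition dtopology :: "'a set \<Rightarrow> ('a \<Rightarrow> 'a \<Rightarrow> real) \<Rightarrow> 'a topology" where
  "dtopology X d = topology (dopen X d)"

lemma istopology_dopen: "istopology (dopen X d)"
  unfolding istopology_def
proof (intro conjI allI impI)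
  fix S T assume "dopen X d S" "dopen X d T"
  then have S: "S \<subseteq> X" "\<forall>x \<in> S. \<exists>r > 0. dball X d x r \<subseteq> S"
    and T: "\<forall>x \<in> T. \<exists>r > 0. dball X d x r \<subseteq> T"
    by (auto simp: dopen_def)
  have "\<exists>r > 0. dball X d x r \<subseteq> S \<inter> T" if x: "x \<in> S \<inter> T" for x
  proof -
    obtain r s where "r > 0" "dball X d x r \<subseteq> S" "s > 0" "dball X d x s \<subseteq> T"
      using S T x by blast
    then have "min r s > 0 \<and> dball X d x (min r s) \<subseteq> S \<inter> T"
      by (auto simp: dball_def)
    then show ?thesis by blast
  qed
  with S show "dopen X d (S \<inter> T)"
    unfolding dopen_def by blast
next
  fix \<K> assume "\<forall>K \<in> \<K>. dopen X d K"
  then show "dopen X d (\<Union>\<K>)"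
    unfolding dopen_def by (meson Union_iff Union_least Union_upper subset_trans)
qed

lemma openin_dtopology: "openin (dtopology X d) = dopen X d"
  unfolding dtopology_def by (rule topology_inverse'[OF istopology_dopen])

lemma (in distance_space) topspace_dtopology: "topspace (dtopology X d) = X"
proof -
  have "dopen X d X"
    unfolding dopen_def dball_def using zero_less_one by blast
  then have "X \<subseteq> topspace (dtopology X d)"
    by (metis openin_dtopology openin_subset)
  moreover have "topspace (dtopology X d) \<subseteq> X"
    using openin_topspace[of "dtopology X d"] by (simp add: openin_dtopology dopen_def)
  ultimately show ?thesis by blast
qed

end

theory Submission
  imports Defs
begin

text \<open>Being a base for \<open>dtopology X d\<close> means two things: the balls are open, and
  they generate every open set by unions. The second holds in every distance space
  (\<open>dopen_eq_Union_dballs\<close>), so only the first is left, and it is the left-hand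
  side.\<close>

lemma (in distance_space) centre_in_dball: "\<lbrakk>x \<in> X; r > 0\<rbrakk> \<Longrightarrow> x \<in> dball X d x r"
  using zero_iff[of x x] by (simp add: dball_def)

text \<open>Openness puts a ball centred at each point of \<open>U\<close> inside \<open>U\<close>,
  and a ball contains its centre. The balls themselves may fail to be open.\<close>

lemma (in distance_space) dopen_eq_Union_dballs:
  assumes "dopen X d U"
  shows "U = \<Union>{B \<in> dballs X d. B \<subseteq> U}"
proof (intro equalityI subsetI)
  fix x assume "x \<in> U"
  then obtain r where "x \<in> X" "r > 0" "dball X d x r \<subseteq> U"
    using assms unfolding dopen_def by blast
  then show "x \<in> \<Union>{B \<in> dballs X d. B \<subseteq> U}"
    using centre_in_dball unfolding dballs_def by blast
qed blast

theorem theorem3p10: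
  fixes X :: "'a set" and d :: "'a \<Rightarrow> 'a \<Rightarrow> real"
  assumes "distance_space X d"
  shows "(\<forall>B \<in> dballs X d. dopen X d B) \<longleftrightarrow> base_of (dballs X d) (dtopology X d)"
proof -
  interpret distance_space X d by (rule assms)
  \<comment> \<open>This is the union clause of \<open>base_of\<close>, obtained without assuming
    either side of the equivalence.\<close>
  have "\<exists>\<C> \<subseteq> dballs X d. U = \<Union>\<C>" if "dopen X d U" for U
    using dopen_eq_Union_dballs[OF that] by (intro exI[of _ "{B \<in> dballs X d. B \<subseteq> U}"]) blast
  then show ?thesis
    unfolding base_of_def openin_dtopology by blast
qed

end
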